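(* For every integer $n\ge 0$ and every integer $k\ge 1$, one has, as polynomials in $x$ (i.e. for all $x\in\mathbb{C}_p$), \[ (-1)^n\,\widehat{D}_n^{(k)}(x)=B_n^{(n+k+1)}(x+k+1). \]
   Context: Fix a prime $p$. $\mathbb{Z}_p$ is the ring of $p$-adic integers and $\mathbb{C}_p$ is the completion of an algebraic closure of $\mathbb{Q}_p$. For a uniformly differentiable function $f$ on $\mathbb{Z}_p$ (with values in $\mathbb{C}_p$), the $p$-adic invariant (Volkenborn) integral is $\int_{\mathbb{Z}_p}f(x)\,d\mu(x)=\lim_{N\to\infty}\frac{1}{p^N}\sum_{x=0}^{p^N-1}f(x)$. Write $y^{(n)}=y(y+1)\cdots(y+n-1)$ for the rising factorial (with $y^{(0)}=1$). The Daehee polynomials of the second kind of order $k$ are defined by the $k$-fold iterated integral \[ \widehat{D}_n^{(k)}(x)=\int_{\mathbb{Z}_p}\cdots\int_{\mathbb{Z}_p}(x_1+\cdots+x_k-x)^{(n)}\,d\mu(x_1)\cdots d\mu(x_k). \] The Bernoulli polynomials of order $\alpha\in\mathbb{N}$ are defined by $\left(\frac{t}{e^t-1}\right)^{\alpha}e^{xt}=\sum_{n\ge0}B_n^{(\alpha)}(x)\frac{t^n}{n!}$. *)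

theory Defs
  imports "HOL-Analysis.Analysis" "HOL-Computational_Algebra.Computational_Algebra"
begin

class complete_valued_field = field_char_0 + complete_space +
  fixes valuation_abs :: "'a \<Rightarrow> real"
  assumes dist_valuation_abs: "dist x y = valuation_abs (x - y)"
    and valuation_abs_mult: "valuation_abs (x * y) = valuation_abs x * valuation_abs y"

definition padic_abs :: "nat \<Rightarrow> rat \<Rightarrow> real" where
  "padic_abs p q =
     (if q = 0 then 0
      else case quotient_of q of (a, b) \<Rightarrow>
        real p powi (int (multiplicity (int p) b) - int (multiplicity (int p) a)))"

(* In a complete field whose absolute value extends the p-adic one on the rationals,
   the closure of the rationals is their completion, i.e. a copy of Q_p; the
   dependence on p is hidden in the metric of the type. *)
definition padic_numbers :: "'a::complete_valued_field set" where
  "padic_numbers = closure \<rat>"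

definition padic_integers :: "'a::complete_valued_field set" where
  "padic_integers = {x \<in> padic_numbers. valuation_abs x \<le> 1}"

definition padic_algebraic :: "'a::complete_valued_field set" where
  "padic_algebraic =
     {x. \<exists>q. q \<noteq> 0 \<and> (\<forall>i. coeff q i \<in> padic_numbers) \<and> poly q x = 0}"

(* The field 'a is the completion C_p of an algebraic closure of Q_p: its absolute value
   extends the p-adic one, the elements algebraic over Q_p form an algebraically closed
   field and are dense, and completeness and multiplicativity come from the class.
   These properties determine 'a up to isometric field isomorphism. The ultrametric
   inequality follows from the triangle inequality and the values on the rationals. *)
definition padic_complex_field ::
    "nat \<Rightarrow> 'a::complete_valued_field itself \<Rightarrow> bool" where
  "padic_complex_field p T \<longleftrightarrow>
     (\<forall>q. valuation_abs (of_rat q :: 'a) = padic_abs p q) \<and>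
     (\<forall>q :: 'a poly. degree q > 0 \<and> (\<forall>i. coeff q i \<in> padic_algebraic) \<longrightarrow>
        (\<exists>x \<in> padic_algebraic. poly q x = 0)) \<and>
     closure (padic_algebraic :: 'a set) = UNIV"

(* The difference quotient of f has a limit as (x, y) tends to (a, a) in Z_p x Z_p off the
   diagonal, for every a in Z_p; only the values of f on Z_p matter. *)
definition padic_uniformly_differentiable ::
    "('a::complete_valued_field \<Rightarrow> 'a) \<Rightarrow> bool" where
  "padic_uniformly_differentiable f \<longleftrightarrow>
     (\<forall>a \<in> padic_integers. \<exists>L.
        ((\<lambda>(x, y). (f x - f y) / (x - y)) \<longlongrightarrow> L)
          (at (a, a) within {(x, y). x \<in> padic_integers \<and> y \<in> padic_integers \<and> x \<noteq> y}))"

definition has_volkenborn_integral ::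
    "nat \<Rightarrow> ('a::complete_valued_field \<Rightarrow> 'a) \<Rightarrow> 'a \<Rightarrow> bool" where
  "has_volkenborn_integral p f I \<longleftrightarrow>
     padic_uniformly_differentiable f \<and>
     (\<lambda>N. 1 / of_nat (p ^ N) * (\<Sum>x<p ^ N. f (of_nat x))) \<longlonglongrightarrow> I"

definition volkenborn_integral ::
    "nat \<Rightarrow> ('a::complete_valued_field \<Rightarrow> 'a) \<Rightarrow> 'a" where
  "volkenborn_integral p f = (THE I. has_volkenborn_integral p f I)"

(* The integrand takes the list of variables [x_1, ..., x_k]; x_1 is integrated innermost
   and x_k outermost. *)
primrec iterated_volkenborn_integral ::
    "nat \<Rightarrow> nat \<Rightarrow> ('a::complete_valued_field list \<Rightarrow> 'a) \<Rightarrow> 'a" where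
  "iterated_volkenborn_integral p 0 f = f []"
| "iterated_volkenborn_integral p (Suc k) f =
     volkenborn_integral p (\<lambda>y. iterated_volkenborn_integral p k (\<lambda>xs. f (xs @ [y])))"

definition daehee_second_kind ::
    "nat \<Rightarrow> nat \<Rightarrow> nat \<Rightarrow> 'a::complete_valued_field \<Rightarrow> 'a" where
  "daehee_second_kind p k n x =
     iterated_volkenborn_integral p k (\<lambda>xs. pochhammer (sum_list xs - x) n)"

(* The quotient is taken in the ring of power series, where division cancels the common
   factor X, so it is the series of t / (e^t - 1) with constant term 1. *)
definition bernoulli_polynomial_order ::
    "nat \<Rightarrow> nat \<Rightarrow> 'a::field_char_0 \<Rightarrow> 'a" where
  "bernoulli_polynomial_order \<alpha> n x =
     fact n * fps_nth ((fps_X / (fps_exp 1 - 1)) ^ \<alpha> * fps_exp x) n"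

end

theory Submission
  imports Defs
begin

text \<open>
  If a polynomial \<open>S\<close> satisfies \<open>S (y + 1) - S y = f y\<close>, then the sum of \<open>f\<close> over
  \<open>0, \<dots>, p\<^sup>N - 1\<close> telescopes, and the Volkenborn integral of \<open>y \<mapsto> f (y + c)\<close> is \<open>S' c\<close>,
  because \<open>p\<^sup>N\<close> tends to \<open>0\<close>.  Write \<open>B n \<alpha>\<close> for the Bernoulli polynomial of degree \<open>n\<close>
  and order \<open>\<alpha>\<close>.  Since \<open>B (n + 1) (\<alpha> + 1)\<close> has forward difference \<open>(n + 1) B n \<alpha>\<close>
  and derivative \<open>(n + 1) B n (\<alpha> + 1)\<close>, each integration raises the order by one.  This
  reduces the theorem to the case \<open>k = 0\<close>, which is \<open>B n (n + 1) x = (x - 1) \<cdots> (x - n)\<close>.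
  That formula follows by induction on \<open>n\<close> from the differential equation
  \<open>t u' = u - t u - u\<^sup>2\<close> of \<open>u = t / (e\<^sup>t - 1)\<close>.
\<close>

section \<open>Complete valued fields\<close>

lemma valuation_abs_eq_dist: "valuation_abs (x :: 'a::complete_valued_field) = dist x 0"
  by (simp add: dist_valuation_abs)

lemma dist_add_left_cancel [simp]:
  "dist (a + x) (a + y) = dist x (y :: 'a::complete_valued_field)"
  by (simp add: dist_valuation_abs)

lemma dist_add_right_cancel [simp]:
  "dist (x + a) (y + a) = dist x (y :: 'a::complete_valued_field)"
  by (simp add: dist_valuation_abs)

lemma dist_mult_left:
  "dist (a * x) (a * y) = dist a 0 * dist x (y :: 'a::complete_valued_field)"
  by (simp add: dist_valuation_abs flip: valuation_abs_mult right_diff_distrib)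

lemma dist_mult_right:
  "dist (x * a) (y * a) = dist x y * dist (a :: 'a::complete_valued_field) 0"
  by (simp add: dist_valuation_abs flip: valuation_abs_mult left_diff_distrib)

lemma dist_minus_minus: "dist (- x) (- y) = dist x (y :: 'a::complete_valued_field)"
  by (subst dist_commute) (simp add: dist_valuation_abs)

text \<open>The class supplies only a metric and a multiplicative absolute value. The estimate |xy -
  ab| \<le> |x - a||y| + |a||y - b| makes multiplication continuous, so that
  \<open>tendsto_mult\<close> applies.\<close>

instance complete_valued_field \<subseteq> topological_semigroup_mult
proof
  fix a b :: 'a
  have "((\<lambda>x. dist (fst x) a * dist (snd x) 0 + dist a 0 * dist (snd x) b) \<longlongrightarrow>
      dist a a * dist b 0 + dist a 0 * dist b b) (nhds a \<times>\<^sub>F nhds b)"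
    by (intro tendsto_intros filterlim_fst filterlim_snd)
  then have "((\<lambda>x. dist (fst x) a * dist (snd x) 0 + dist a 0 * dist (snd x) b) \<longlongrightarrow> 0)
      (nhds a \<times>\<^sub>F nhds b)"
    by simp
  then have "((\<lambda>x. dist (fst x * snd x) (a * b)) \<longlongrightarrow> 0) (nhds a \<times>\<^sub>F nhds b)"
  proof (rule Lim_null_comparison[rotated], intro always_eventually allI)
    fix x :: "'a \<times> 'a"
    have "dist (fst x * snd x) (a * b) \<le>
        dist (fst x * snd x) (a * snd x) + dist (a * snd x) (a * b)"
      by (rule dist_triangle)
    then show "norm (dist (fst x * snd x) (a * b)) \<le>
        dist (fst x) a * dist (snd x) 0 + dist a 0 * dist (snd x) b"
      by (simp add: dist_mult_left dist_mult_right)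
  qed
  then show "((\<lambda>x. fst x * snd x) \<longlongrightarrow> a * b) (nhds a \<times>\<^sub>F nhds b)"
    by (rule iffD2[OF tendsto_dist_iff])
qed

instance complete_valued_field \<subseteq> topological_ab_group_add
proof
  fix a b :: 'a
  have "((\<lambda>x. dist (fst x) a + dist (snd x) b) \<longlongrightarrow> dist a a + dist b b) (nhds a \<times>\<^sub>F nhds b)"
    by (intro tendsto_intros filterlim_fst filterlim_snd)
  then have "((\<lambda>x. dist (fst x) a + dist (snd x) b) \<longlongrightarrow> 0) (nhds a \<times>\<^sub>F nhds b)"
    by simp
  then have "((\<lambda>x. dist (fst x + snd x) (a + b)) \<longlongrightarrow> 0) (nhds a \<times>\<^sub>F nhds b)"
  proof (rule Lim_null_comparison[rotated], intro always_eventually allI)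
    fix x :: "'a \<times> 'a"
    show "norm (dist (fst x + snd x) (a + b)) \<le> dist (fst x) a + dist (snd x) b"
      using dist_triangle[of "fst x + snd x" "a + b" "a + snd x"] by simp
  qed
  then show "((\<lambda>x. fst x + snd x) \<longlongrightarrow> a + b) (nhds a \<times>\<^sub>F nhds b)"
    by (rule iffD2[OF tendsto_dist_iff])
next
  fix a :: 'a
  have "((\<lambda>x. dist x a) \<longlongrightarrow> dist a a) (nhds a)"
    by (intro tendsto_dist filterlim_ident tendsto_const)
  then have "((\<lambda>x. dist (- x) (- a)) \<longlongrightarrow> 0) (nhds a)"
    by (simp add: dist_minus_minus)
  then show "(uminus \<longlongrightarrow> - a) (nhds a)"
    by (rule iffD2[OF tendsto_dist_iff])
qed

lemma tendsto_poly_valued_field: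
  fixes q :: "'a::complete_valued_field poly"
  assumes "(u \<longlongrightarrow> a) F"
  shows "((\<lambda>t. poly q (u t)) \<longlongrightarrow> poly q a) F"
proof (induction q)
  case (pCons c q)
  then show ?case
    unfolding poly_pCons by (intro tendsto_add tendsto_mult tendsto_const assms)
qed simp

text \<open>Both points move, so one statement serves twice: for uniform differentiability, where
  (x, y) tends to (a, a), and for the Volkenborn limit, where \<open>v\<close> is constantly
  0.\<close>

lemma tendsto_poly_difference_quotient:
  fixes q :: "'a::complete_valued_field poly"
  assumes u: "(u \<longlongrightarrow> a) F" and v: "(v \<longlongrightarrow> a) F" and ne: "\<forall>\<^sub>F t in F. u t \<noteq> v t"
  shows "((\<lambda>t. (poly q (u t) - poly q (v t)) / (u t - v t)) \<longlongrightarrow> poly (pderiv q) a) F"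
proof (induction q)
  case 0
  show ?case by simp
next
  case (pCons c q)
  \<comment> \<open>Horner step: u q(u) - v q(v) = (u - v) q(u) + v (q(u) - q(v)). The limit q(a) +
    a q'(a) is the product rule for c + X q.\<close>
  have "((\<lambda>t. poly q (u t) + v t * ((poly q (u t) - poly q (v t)) / (u t - v t)))
      \<longlongrightarrow> poly q a + a * poly (pderiv q) a) F"
    by (intro tendsto_add tendsto_mult tendsto_poly_valued_field u v pCons.IH)
  moreover have "\<forall>\<^sub>F t in F. poly q (u t) + v t * ((poly q (u t) - poly q (v t)) / (u t - v t)) =
      (poly (pCons c q) (u t) - poly (pCons c q) (v t)) / (u t - v t)"
    using ne by eventually_elim (simp add: field_simps)
  ultimately show ?case
    by (simp add: pderiv_pCons tendsto_cong)
qed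

section \<open>Volkenborn integrals of polynomials\<close>

text \<open>The absolute value restricts to the p-adic one on the rationals, so p^N has absolute
  value p^(-N).\<close>

lemma tendsto_prime_power_zero:
  assumes "prime p" and "padic_complex_field p TYPE('a::complete_valued_field)"
  shows "(\<lambda>N. of_nat (p ^ N) :: 'a) \<longlonglongrightarrow> 0"
proof -
  have p: "p > 1" using assms(1) by (rule prime_gt_1_nat)
  have "dist (of_nat (p ^ N) :: 'a) 0 = inverse (real p) ^ N" for N
  proof -
    have "dist (of_nat (p ^ N) :: 'a) 0 = valuation_abs (of_rat (of_int (int p ^ N)) :: 'a)"
      by (simp add: valuation_abs_eq_dist of_rat_power)
    also have "\<dots> = padic_abs p (of_int (int p ^ N))"
      using assms(2) unfolding padic_complex_field_def by blast
    also have "\<dots> = real p powi (- int N)"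
      using p assms(1) by (simp add: padic_abs_def del: of_int_power)
    finally show ?thesis
      by (simp add: power_int_minus power_inverse)
  qed
  moreover have "(\<lambda>N. inverse (real p) ^ N) \<longlonglongrightarrow> 0"
    using p by (intro LIMSEQ_power_zero) (simp add: inverse_less_1_iff)
  ultimately have "(\<lambda>N. dist (of_nat (p ^ N) :: 'a) 0) \<longlonglongrightarrow> 0"
    by (simp only:)
  then show ?thesis
    by (rule iffD2[OF tendsto_dist_iff])
qed

lemma padic_uniformly_differentiable_poly:
  "padic_uniformly_differentiable (poly (q :: 'a::complete_valued_field poly))"
  unfolding padic_uniformly_differentiable_def
proof (intro ballI exI)
  fix a :: 'a
  let ?F = "at (a, a) within
    {(x, y). x \<in> padic_integers \<and> y \<in> padic_integers \<and> x \<noteq> y}"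
  have "(fst \<longlongrightarrow> a) ?F" "(snd \<longlongrightarrow> a) ?F"
    using tendsto_fst[OF tendsto_ident_at, of "(a, a)"] tendsto_snd[OF tendsto_ident_at, of "(a, a)"]
    by simp_all
  moreover have "\<forall>\<^sub>F z in ?F. fst z \<noteq> snd z"
    by (auto simp: eventually_at_filter intro!: always_eventually)
  ultimately show "((\<lambda>(x, y). (poly q x - poly q y) / (x - y)) \<longlongrightarrow> poly (pderiv q) a) ?F"
    unfolding case_prod_unfold by (rule tendsto_poly_difference_quotient)
qed

lemma has_volkenborn_integral_forward_difference:
  fixes S :: "'a::complete_valued_field poly"
  assumes "prime p" and "padic_complex_field p TYPE('a)"
  shows "has_volkenborn_integral p (\<lambda>y. poly S (y + 1) - poly S y) (poly (pderiv S) 0)"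
  unfolding has_volkenborn_integral_def
proof
  have "(\<lambda>y. poly S (y + 1) - poly S y) = poly (S \<circ>\<^sub>p [:1, 1:] - S)"
    by (simp add: fun_eq_iff poly_pcompose add.commute)
  then show "padic_uniformly_differentiable (\<lambda>y. poly S (y + 1) - poly S y)"
    using padic_uniformly_differentiable_poly by metis
next
  have "(\<Sum>x<p ^ N. poly S (of_nat x + 1) - poly S (of_nat x))
      = poly S (of_nat (p ^ N)) - poly S 0" for N
    using sum_lessThan_telescope[of "\<lambda>x. poly S (of_nat x)" "p ^ N"]
    by (simp add: add.commute)
  \<comment> \<open>After telescoping, the averages are difference quotients of \<open>S\<close>
    between p^N and 0.\<close>
  moreover have "(\<lambda>N. (poly S (of_nat (p ^ N)) - poly S 0) / (of_nat (p ^ N) - 0))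
      \<longlonglongrightarrow> poly (pderiv S) 0"
    using assms prime_gt_0_nat[OF assms(1)]
    by (intro tendsto_poly_difference_quotient tendsto_prime_power_zero tendsto_const) auto
  ultimately show "(\<lambda>N. 1 / of_nat (p ^ N) *
      (\<Sum>x<p ^ N. poly S (of_nat x + 1) - poly S (of_nat x))) \<longlonglongrightarrow> poly (pderiv S) 0"
    by simp
qed

lemma volkenborn_integral_forward_difference:
  fixes S :: "'a::complete_valued_field poly"
  assumes "prime p" and "padic_complex_field p TYPE('a)"
  shows "volkenborn_integral p (\<lambda>y. poly S (y + 1) - poly S y) = poly (pderiv S) 0"
  unfolding volkenborn_integral_def
proof (rule the_equality)
  show *: "has_volkenborn_integral p (\<lambda>y. poly S (y + 1) - poly S y) (poly (pderiv S) 0)"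
    using assms by (rule has_volkenborn_integral_forward_difference)
  show "I = poly (pderiv S) 0"
    if "has_volkenborn_integral p (\<lambda>y. poly S (y + 1) - poly S y) I" for I
    using that * unfolding has_volkenborn_integral_def by (blast intro: LIMSEQ_unique)
qed

section \<open>Bernoulli polynomials of higher order\<close>

abbreviation bernoulli_fps :: "'a::field_char_0 fps" where
  "bernoulli_fps \<equiv> fps_X / (fps_exp 1 - 1)"

lemma fps_exp_1_minus_1_nonzero: "fps_exp 1 - 1 \<noteq> (0 :: 'a::field_char_0 fps)"
proof
  assume "fps_exp 1 - 1 = (0 :: 'a fps)"
  then have "fps_nth (fps_exp 1 - 1 :: 'a fps) 1 = 0" by simp
  then show False by simp
qed

text \<open>The division is exact because e^t - 1 has subdegree 1, the same as
  \<open>fps_X\<close>.\<close>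

lemma bernoulli_fps_mult: "bernoulli_fps * (fps_exp 1 - 1) = (fps_X :: 'a::field_char_0 fps)"
proof (rule dvd_div_mult_self)
  have "subdegree (fps_exp 1 - 1 :: 'a fps) = 1"
    by (rule subdegreeI) auto
  then show "fps_exp 1 - 1 dvd (fps_X :: 'a fps)"
    using fps_exp_1_minus_1_nonzero by (simp add: fps_dvd_iff)
qed

text \<open>With g = e^t - 1 one has g' = g + 1. Differentiating u g = t, multiplying by t and
  cancelling g gives the equation.\<close>

lemma bernoulli_fps_deriv:
  "fps_X * fps_deriv bernoulli_fps =
    (bernoulli_fps - fps_X * bernoulli_fps - bernoulli_fps\<^sup>2 :: 'a::field_char_0 fps)"
proof -
  define g :: "'a fps" where "g = fps_exp 1 - 1"
  define u :: "'a fps" where "u = fps_X / g"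
  have ug: "u * g = fps_X"
    unfolding u_def g_def by (rule bernoulli_fps_mult)
  have "fps_deriv (u * g) = 1"
    by (simp add: ug)
  then have d: "fps_deriv u * g + u * (g + 1) = 1"
    by (simp add: g_def algebra_simps)
  have "(fps_X * fps_deriv u) * g = fps_X * (fps_deriv u * g + u * (g + 1)) - fps_X * u * (g + 1)"
    by (simp add: algebra_simps)
  also have "\<dots> = fps_X - fps_X * u * g - u * fps_X"
    unfolding d by (simp add: algebra_simps)
  also have "\<dots> = (u - fps_X * u - u\<^sup>2) * g"
    by (simp add: algebra_simps power2_eq_square flip: ug)
  finally show ?thesis
    using fps_exp_1_minus_1_nonzero unfolding u_def g_def by simp
qed

lemma bernoulli_polynomial_order_0 [simp]: "bernoulli_polynomial_order \<alpha> 0 x = 1"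
proof -
  have "fps_nth (bernoulli_fps * (fps_exp 1 - 1)) 1 = fps_nth (fps_X :: 'a fps) 1"
    by (simp only: bernoulli_fps_mult)
  then have "fps_nth (bernoulli_fps :: 'a fps) 0 = 1"
    by (simp add: fps_mult_nth)
  then show ?thesis
    by (simp add: bernoulli_polynomial_order_def fps_nth_power_0)
qed

lemma bernoulli_polynomial_order_Suc_Suc:
  "bernoulli_polynomial_order (Suc (Suc n)) (Suc n) x =
     (x - of_nat (Suc n)) * bernoulli_polynomial_order (Suc n) n x"
proof -
  define u :: "'a fps" where "u = bernoulli_fps"
  define a :: 'a where "a = of_nat (Suc n)"
  define w where "w = u ^ Suc n * fps_exp x"
  have "fps_deriv (u ^ Suc n) = fps_const a * fps_deriv u * u ^ n"
    by (subst fps_deriv_power) (simp add: a_def)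
  then have "fps_X * fps_deriv w = fps_const a * u ^ n * (fps_X * fps_deriv u) * fps_exp x
      + fps_const x * (fps_X * w)"
    by (simp add: w_def algebra_simps del: power_Suc)
  also have "fps_X * fps_deriv u = u - fps_X * u - u\<^sup>2"
    unfolding u_def by (rule bernoulli_fps_deriv)
  also have "fps_const a * u ^ n * (u - fps_X * u - u\<^sup>2) * fps_exp x + fps_const x * (fps_X * w) =
      fps_const a * w - fps_const a * (u ^ Suc (Suc n) * fps_exp x)
      + fps_const (x - a) * (fps_X * w)"
    by (simp add: w_def algebra_simps power2_eq_square flip: fps_const_sub)
  finally have "fps_nth (fps_X * fps_deriv w) (Suc n) =
      fps_nth (fps_const a * w - fps_const a * (u ^ Suc (Suc n) * fps_exp x)
        + fps_const (x - a) * (fps_X * w)) (Suc n)"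
    by simp
  \<comment> \<open>The exponent of u in \<open>w\<close> equals the index of the coefficient, so t
    w' contributes the same term a w_(n+1) as the right-hand side. The two cancel, leaving a
    recursion between orders n + 2 and n + 1.\<close>
  then have "a * fps_nth w (Suc n) = a * fps_nth w (Suc n)
      - a * fps_nth (u ^ Suc (Suc n) * fps_exp x) (Suc n) + (x - a) * fps_nth w n"
    by (simp add: a_def del: power_Suc of_nat_Suc)
  then have "a * fps_nth (u ^ Suc (Suc n) * fps_exp x) (Suc n) = (x - a) * fps_nth w n"
    by (simp add: algebra_simps del: power_Suc)
  then have "fact n * (a * fps_nth (u ^ Suc (Suc n) * fps_exp x) (Suc n)) =
      fact n * ((x - a) * fps_nth w n)"
    by (rule arg_cong)
  then show ?thesis
    unfolding bernoulli_polynomial_order_def w_def u_def a_def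
    by (simp add: mult_ac del: power_Suc of_nat_Suc)
qed

lemma bernoulli_polynomial_order_Suc_eq_pochhammer:
  "bernoulli_polynomial_order (Suc n) n x = (-1) ^ n * pochhammer (1 - x) n"
proof (induction n)
  case (Suc n)
  then show ?case
    unfolding bernoulli_polynomial_order_Suc_Suc by (simp add: pochhammer_Suc algebra_simps)
qed simp

text \<open>The shift of x multiplies the generating series by e^t, and u (e^t - 1) = t trades one
  factor u for t. This lowers order and degree by one; the factor n + 1 comes from the
  factorials.\<close>

lemma bernoulli_polynomial_order_forward_difference:
  "bernoulli_polynomial_order (Suc \<alpha>) (Suc n) (x + 1) - bernoulli_polynomial_order (Suc \<alpha>) (Suc n) x
    = of_nat (Suc n) * bernoulli_polynomial_order \<alpha> n x"
proof -
  define u :: "'a fps" where "u = bernoulli_fps"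
  have "u ^ Suc \<alpha> * fps_exp (x + 1) - u ^ Suc \<alpha> * fps_exp x
      = u ^ \<alpha> * fps_exp x * (u * (fps_exp 1 - 1))"
    by (simp add: fps_exp_add_mult algebra_simps)
  also have "u * (fps_exp 1 - 1) = fps_X"
    unfolding u_def by (rule bernoulli_fps_mult)
  finally have "fps_nth (u ^ Suc \<alpha> * fps_exp (x + 1)) (Suc n) - fps_nth (u ^ Suc \<alpha> * fps_exp x) (Suc n)
      = fps_nth (u ^ \<alpha> * fps_exp x) n"
    by (simp flip: fps_sub_nth del: power_Suc)
  then show ?thesis
    unfolding bernoulli_polynomial_order_def u_def
    by (simp add: algebra_simps flip: right_diff_distrib del: power_Suc)
qed

text \<open>The integration lemmas take antidifferences of type \<open>poly\<close>; this is the
  polynomial in x obtained by expanding e^(xt).\<close>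

definition bernoulli_poly_order :: "nat \<Rightarrow> nat \<Rightarrow> 'a::field_char_0 poly" where
  "bernoulli_poly_order \<alpha> n =
     (\<Sum>i\<le>n. monom (fact n * fps_nth (bernoulli_fps ^ \<alpha>) (n - i) / fact i) i)"

lemma poly_bernoulli_poly_order:
  "poly (bernoulli_poly_order \<alpha> n) x = bernoulli_polynomial_order \<alpha> n x"
  unfolding bernoulli_poly_order_def bernoulli_polynomial_order_def
  by (subst mult.commute[of "_ ^ \<alpha>"])
    (simp add: poly_sum poly_monom fps_mult_nth sum_distrib_left atLeast0AtMost mult_ac)

lemma coeff_bernoulli_poly_order:
  "coeff (bernoulli_poly_order \<alpha> n) i =
     (if i \<le> n then fact n * fps_nth (bernoulli_fps ^ \<alpha>) (n - i) / fact i else 0)"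
  unfolding bernoulli_poly_order_def by (simp add: coeff_sum)

lemma pderiv_bernoulli_poly_order:
  "pderiv (bernoulli_poly_order \<alpha> (Suc n)) = smult (of_nat (Suc n)) (bernoulli_poly_order \<alpha> n)"
  by (rule poly_eqI) (simp add: coeff_pderiv coeff_bernoulli_poly_order divide_simps del: of_nat_Suc)

section \<open>Daehee polynomials\<close>

lemma volkenborn_integral_bernoulli:
  fixes b c :: "'a::complete_valued_field"
  assumes "prime p" and "padic_complex_field p TYPE('a)"
  shows "volkenborn_integral p (\<lambda>y. b * bernoulli_polynomial_order \<alpha> n (c - y)) =
    b * bernoulli_polynomial_order (Suc \<alpha>) n (c + 1)"
proof -
  define m :: 'a where "m = of_nat (Suc n)"
  \<comment> \<open>The argument c + 1 - y is reflected: raising y by one moves it from c - y + 1 to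
    c - y, the reverse of a forward difference, hence the minus sign. The chain rule cancels that
    sign in the derivative.\<close>
  define S where
    "S = smult (- b / m) (bernoulli_poly_order (Suc \<alpha>) (Suc n) \<circ>\<^sub>p [:c + 1, -1:])"
  have m: "m \<noteq> 0"
    unfolding m_def by (rule of_nat_neq_0)
  have "poly S (y + 1) - poly S y = b * bernoulli_polynomial_order \<alpha> n (c - y)" for y
  proof -
    have "poly S (y + 1) - poly S y =
        b / m * (bernoulli_polynomial_order (Suc \<alpha>) (Suc n) (c - y + 1)
          - bernoulli_polynomial_order (Suc \<alpha>) (Suc n) (c - y))"
      by (simp add: S_def poly_pcompose poly_bernoulli_poly_order algebra_simps)
    also have "\<dots> = b * bernoulli_polynomial_order \<alpha> n (c - y)"
      unfolding bernoulli_polynomial_order_forward_difference using m by (simp add: m_def)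
    finally show ?thesis .
  qed
  moreover have "poly (pderiv S) 0 = b * bernoulli_polynomial_order (Suc \<alpha>) n (c + 1)"
    using m unfolding S_def
    by (simp add: pderiv_minus pderiv_smult pderiv_pcompose pderiv_bernoulli_poly_order pderiv_pCons
        poly_pcompose poly_bernoulli_poly_order pcompose_smult
        del: of_nat_Suc flip: m_def)
  ultimately show ?thesis
    using volkenborn_integral_forward_difference[OF assms, of S] by simp
qed

lemma iterated_volkenborn_integral_pochhammer:
  fixes x :: "'a::complete_valued_field"
  assumes "prime p" and "padic_complex_field p TYPE('a)"
  shows "iterated_volkenborn_integral p k (\<lambda>xs. pochhammer (sum_list xs - x) n) =
    (-1) ^ n * bernoulli_polynomial_order (n + k + 1) n (x + of_nat k + 1)"
proof (induction k arbitrary: x)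
  case 0
  show ?case
    \<comment> \<open>At x + 1 the factor 1 - (x + 1) is -x, and the two signs (-1)^n multiply to
      1.\<close>
    by (simp add: bernoulli_polynomial_order_Suc_eq_pochhammer flip: mult.assoc power_add)
next
  case (Suc k)
  \<comment> \<open>The outermost variable y is fixed while the inner k integrals are evaluated, so
    it is absorbed by replacing x with x - y; this is why the induction generalizes x.\<close>
  have "iterated_volkenborn_integral p k (\<lambda>xs. pochhammer (sum_list (xs @ [y]) - x) n) =
      (-1) ^ n * bernoulli_polynomial_order (n + k + 1) n ((x + of_nat k + 1) - y)" for y
    using Suc.IH[of "x - y"] by (simp add: algebra_simps)
  then show ?case
    by (simp add: volkenborn_integral_bernoulli[OF assms] algebra_simps)
qed

theorem theorem10:
  fixes p n k :: nat and x :: "'a::complete_valued_field"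
  assumes "prime p"
    and "padic_complex_field p TYPE('a)"
    and "k \<ge> 1"
  shows "(-1) ^ n * daehee_second_kind p k n x =
         bernoulli_polynomial_order (n + k + 1) n (x + of_nat k + 1)"
  unfolding daehee_second_kind_def iterated_volkenborn_integral_pochhammer[OF assms(1,2)]
  by (simp flip: mult.assoc power_add)

end
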